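(* Suppose that $f$ is a log-regular transcendental entire function which has the annular domain property for some $m>1$. Let $P(w,z)$ be a (complex) polynomial in two variables of degree at least one in $w$, and let $Q(z)$ be a polynomial of degree at least one. Let $g(z)=P(f(Q(z)),z)$. Then $A_R(g)$ is a spider's web, where $R>0$ is such that $M(r,g)>r$ for $r\ge R$.
   Context: For an entire function $f$ put $M(r,f)=\max_{|z|=r}|f(z)|$ for $r>0$. $f^n$ is the $n$th iterate of $f$, and $M^n(R,f)$ is the $n$th iterate of the map $r\mapsto M(r,f)$ applied to $R$. $\mathbb N=\{1,2,\ldots\}$ and $B(0,r)=\{z\in\mathbb C:|z|<r\}$. For a transcendental entire function $f$ and $R>0$ with $M(r,f)>r$ for all $r\ge R$, define $A_R(f)=\{z\in\mathbb C: |f^n(z)|\ge M^n(R,f)\text{ for } n\in\mathbb N\}$. A set $E\subset\mathbb C$ is a spider's web if $E$ is connected and there is a sequence $(G_n)_{n\in\mathbb N}$ of bounded simply connected domains with $G_n\subset G_{n+1}$ and $\partial G_n\subset E$ for all $n\in\mathbb N$, and $\bigcup_{n\in\mathbb N}G_n=\mathbb C$. An entire function $f$ has the annular domain property for $m>1$ if there exists $R_0>0$ such that, for all $r\ge R_0$, there is a simply connected domain $G=G(r)$ with $B(0,r)\subset G\subset B(0,r^m)$ and $|f(z)|\ge M(r,f)$ for all $z\in\partial G$. A transcendental entire function $f$ is log-regular (with constant $c>0$) if $\phi(t)=\log M(e^t,f)$ satisfies $\phi'(t)/\phi(t)\ge (1+c)/t$ for all large $t$; it is log-regular if this holds for some $c>0$.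 (Since $\phi$ is convex, $\phi'$ exists outside a countable set; at exceptional points $\phi'$ is read as the right derivative.) *)

theory Defs
  imports
    "HOL-Complex_Analysis.Complex_Analysis"
    "HOL-Computational_Algebra.Computational_Algebra"
begin

definition transcendental_entire :: "(complex \<Rightarrow> complex) \<Rightarrow> bool" where
  "transcendental_entire f \<longleftrightarrow>
     f holomorphic_on UNIV \<and> \<not> (\<exists>p :: complex poly. \<forall>z. f z = poly p z)"

(* For f continuous and r \<ge> 0 the supremum is attained; this is M(r, f). *)
definition max_modulus :: "(complex \<Rightarrow> complex) \<Rightarrow> real \<Rightarrow> real" where
  "max_modulus f r = (SUP z\<in>sphere 0 r. norm (f z))"

definition A_set :: "real \<Rightarrow> (complex \<Rightarrow> complex) \<Rightarrow> complex set" where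
  "A_set R f = {z. \<forall>n\<ge>1. norm ((f ^^ n) z) \<ge> (max_modulus f ^^ n) R}"

definition simply_connected_domain :: "complex set \<Rightarrow> bool" where
  "simply_connected_domain G \<longleftrightarrow>
     open G \<and> connected G \<and> G \<noteq> {} \<and> simply_connected G"

(* The sequence of domains is indexed from 0 instead of 1. *)
definition spiders_web :: "complex set \<Rightarrow> bool" where
  "spiders_web E \<longleftrightarrow> connected E \<and>
     (\<exists>G :: nat \<Rightarrow> complex set.
        (\<forall>n. bounded (G n) \<and> simply_connected_domain (G n) \<and>
             G n \<subseteq> G (Suc n) \<and> frontier (G n) \<subseteq> E) \<and>
        (\<Union>n. G n) = UNIV)"

definition annular_domain_property :: "real \<Rightarrow> (complex \<Rightarrow> complex) \<Rightarrow> bool" where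
  "annular_domain_property m f \<longleftrightarrow>
     (\<exists>R0>0. \<forall>r\<ge>R0. \<exists>G. simply_connected_domain G \<and>
        ball 0 r \<subseteq> G \<and> G \<subseteq> ball 0 (r powr m) \<and>
        (\<forall>z\<in>frontier G. norm (f z) \<ge> max_modulus f r))"

definition log_max_modulus :: "(complex \<Rightarrow> complex) \<Rightarrow> real \<Rightarrow> real" where
  "log_max_modulus f t = ln (max_modulus f (exp t))"

(* D is the right derivative of log_max_modulus f at t. By convexity it exists at every t,
   and it is the derivative wherever log_max_modulus f is differentiable. *)
definition log_regular_with :: "real \<Rightarrow> (complex \<Rightarrow> complex) \<Rightarrow> bool" where
  "log_regular_with c f \<longleftrightarrow> transcendental_entire f \<and>
     (\<forall>\<^sub>F t in at_top. \<exists>D.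
        (log_max_modulus f has_real_derivative D) (at_right t) \<and>
        D / log_max_modulus f t \<ge> (1 + c) / t)"

definition log_regular :: "(complex \<Rightarrow> complex) \<Rightarrow> bool" where
  "log_regular f \<longleftrightarrow> (\<exists>c>0. log_regular_with c f)"

(* A polynomial P(w, z) is represented as a polynomial in w whose coefficients are
   polynomials in z; hence degree P is its degree in w, and this is its value at (w, z). *)
definition eval_poly2 :: "complex poly poly \<Rightarrow> complex \<Rightarrow> complex \<Rightarrow> complex" where
  "eval_poly2 P w z = poly (poly P [:w:]) z"

end

theory Submission
  imports Defs
begin

text \<open>Write \<open>M\<close> for the maximum modulus of \<open>g\<close>. The set \<open>A_R(g)\<close> is the decreasing intersection of the closed
  sets \<open>|g^n| \<ge> M^n(R)\<close>, none of which has a compact part cut off from the rest, by the maximum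
  principle; hence \<open>A_R(g)\<close> has no such part either. Suppose that every large disc of radius \<open>S\<close> lies in a
  bounded open set \<open>G(S)\<close> of size at most \<open>b(S)\<close> on whose frontier \<open>|g| > b(M(S))\<close>. The points whose
  orbits stay in the sets \<open>G(M^n(S))\<close> form a bounded neighbourhood of \<open>0\<close> with frontier in \<open>A_R(g)\<close>. Filling
  the component of \<open>0\<close> gives arbitrarily large domains with connected frontier in \<open>A_R(g)\<close>, and these make
  \<open>A_R(g)\<close> connected and a spider's web.

  For \<open>g = P(f(Q(z)), z)\<close>, take \<open>G(S)\<close> to be the preimage under \<open>Q\<close> of the domain that the annular domain
  property gives at radius \<open>S^(kL)\<close>, where \<open>|Q(z)| < S^L\<close> on the disc of radius \<open>S\<close>. Then \<open>b(S)\<close> may be taken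
  to be \<open>S^(ke)\<close> with \<open>e\<close> independent of \<open>k\<close>. Log-regularity gives
  \<open>M(r^k, f) \<ge> M(r, f)^(kJ)\<close> for any prescribed \<open>J\<close> and suitable \<open>k\<close>, which outweighs both this exponent
  and the bounded powers of \<open>M(S^L, f)\<close> lost in passing from \<open>f\<close> to \<open>g\<close>.\<close>

subsection \<open>The maximum modulus\<close>

text \<open>The maximum principle on the closed disc. Continuity on the compact sphere makes the set
  of values bounded above, so the supremum really is an upper bound.\<close>

lemma norm_le_max_modulus:
  assumes "f holomorphic_on UNIV" "norm z \<le> r"
  shows "norm (f z) \<le> max_modulus f r"
proof (rule maximum_modulus_frontier[of f "cball 0 r"])
  have cont: "continuous_on A f" for A
    using assms(1) holomorphic_on_imp_continuous_on holomorphic_on_subset by blast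
  then show "continuous_on (closure (cball 0 r)) f" .
  have "bdd_above ((\<lambda>w. norm (f w)) ` sphere 0 r)"
    by (intro bounded_imp_bdd_above compact_imp_bounded compact_continuous_image
        continuous_intros cont) auto
  then show "norm (f w) \<le> max_modulus f r" if "w \<in> frontier (cball 0 r)" for w
    using that unfolding max_modulus_def by (intro cSUP_upper) auto
qed (use assms in \<open>auto intro: holomorphic_on_subset\<close>)

lemma max_modulus_le:
  assumes "0 \<le> r" "\<And>z. norm z = r \<Longrightarrow> norm (f z) \<le> B"
  shows "max_modulus f r \<le> B"
proof -
  have "sphere (0::complex) r \<noteq> {}"
    using assms(1) by simp
  then show ?thesis
    unfolding max_modulus_def using assms(2) by (intro cSUP_least) auto
qed

lemma max_modulus_mono:
  assumes "f holomorphic_on UNIV" "0 \<le> r" "r \<le> s"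
  shows "max_modulus f r \<le> max_modulus f s"
  using assms by (intro max_modulus_le norm_le_max_modulus) auto

text \<open>A value this large inside the disc would be an interior maximum, which forces
  \<open>f\<close> to be constant.\<close>

lemma norm_less_max_modulus:
  assumes "f holomorphic_on UNIV" "\<not> f constant_on UNIV" "norm z < r"
  shows "norm (f z) < max_modulus f r"
proof (rule ccontr)
  assume "\<not> norm (f z) < max_modulus f r"
  then have "norm (f w) \<le> norm (f z)" if "w \<in> ball 0 r" for w
    using norm_le_max_modulus[OF assms(1), of w r] that by auto
  then have "f constant_on UNIV"
    using assms(3) by (intro maximum_modulus_principle[OF assms(1), where U = "ball 0 r"]) auto
  with assms(2) show False ..
qed

lemma holomorphic_on_funpow:
  assumes "f holomorphic_on UNIV"
  shows "(f ^^ n) holomorphic_on UNIV"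
proof (induction n)
  case (Suc n)
  show ?case
    unfolding funpow.simps
    by (rule holomorphic_on_compose_gen[OF Suc assms]) auto
qed (auto simp: id_def)

lemma continuous_on_funpow:
  assumes "f holomorphic_on UNIV"
  shows "continuous_on A (f ^^ n)"
  using holomorphic_on_funpow[OF assms] holomorphic_on_imp_continuous_on holomorphic_on_subset
  by blast

subsection \<open>A criterion for a spider's web\<close>

text \<open>Take for \<open>V\<close> the complement of the unbounded component of
  \<open>- H\<close>. Its frontier is connected because \<open>H\<close> is, and a bounded connected
  open set with connected frontier is simply connected.\<close>

lemma ex_simply_connected_filling:
  fixes H :: "complex set"
  assumes "open H" "connected H" "bounded H" "H \<noteq> {}"
  shows "\<exists>V. simply_connected_domain V \<and> bounded V \<and> H \<subseteq> V \<and> frontier V \<subseteq> frontier H"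
proof -
  obtain B where B: "B > 0" "H \<subseteq> ball 0 B"
    using bounded_subset_ballD[OF assms(3)] by blast
  \<comment> \<open>The point \<open>B\<close>, on the boundary of a disc containing
    \<open>H\<close>, selects the unbounded component.\<close>
  define C where "C = connected_component_set (- H) (of_real B)"
  have far: "of_real B \<in> - ball (0 :: complex) B" "- ball 0 B \<subseteq> - H"
    using B by auto
  then have comp: "C \<in> components (- H)"
    unfolding C_def by (intro componentsI) auto
  have "connected (- ball (0 :: complex) B)"
    by (intro connected_complement_bounded_convex) auto
  then have "- ball 0 B \<subseteq> C"
    unfolding C_def using far by (intro connected_component_maximal) auto
  then have bdd: "bounded (- C)"
    using bounded_subset[OF bounded_ball, of "- C" 0 B] by blast
  have open_C: "open (- C)"
    using assms(1) closed_components[OF _ comp] by auto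
  have conn: "connected (- C)"
    using component_complement_connected[OF assms(2) comp] .
  have "connected (frontier C)"
    using connected_frontier_component_complement[OF assms(2) comp] .
  then have "simply_connected (- C)"
    using simply_connected_eq_frontier_properties[OF open_C] bdd conn by simp
  moreover have sub: "H \<subseteq> - C"
    using in_components_subset[OF comp] by auto
  moreover have "frontier (- C) \<subseteq> frontier H"
    using frontier_of_components_subset[OF comp] by simp
  ultimately show ?thesis
    using open_C conn bdd assms(4) unfolding simply_connected_domain_def by blast
qed

locale expanding_entire =
  fixes g :: "complex \<Rightarrow> complex" and R :: real
  assumes holo: "g holomorphic_on UNIV"
    and R_pos: "R > 0"
    and expanding: "\<And>r. r \<ge> R \<Longrightarrow> max_modulus g r > r"
begin

abbreviation M :: "real \<Rightarrow> real" where "M \<equiv> max_modulus g"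

lemma not_constant: "\<not> g constant_on UNIV"
proof
  assume "g constant_on UNIV"
  then obtain c where c: "\<And>z. g z = c"
    unfolding constant_on_def by auto
  have "M (max R (norm c)) \<le> norm c"
    using R_pos c by (intro max_modulus_le) auto
  with expanding[of "max R (norm c)"] show False
    by auto
qed

lemma funpow_M_ge:
  assumes "S \<ge> R"
  shows "(M ^^ n) S \<ge> S"
proof (induction n)
  case (Suc n)
  with expanding[of "(M ^^ n) S"] assms show ?case by auto
qed auto

lemma funpow_M_mono:
  assumes "R \<le> S" "S \<le> S'"
  shows "(M ^^ n) S \<le> (M ^^ n) S'"
proof (induction n)
  case (Suc n)
  then show ?case
    using funpow_M_ge[OF assms(1), of n] assms R_pos by (auto intro!: max_modulus_mono[OF holo])
qed (use assms in auto)

text \<open>Domains will be built at arbitrarily large radii; this brings their frontiers into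
  \<open>A_set R g\<close>.\<close>

lemma A_set_antimono:
  assumes "R \<le> S" "S \<le> S'"
  shows "A_set S' g \<subseteq> A_set S g"
proof
  fix z assume "z \<in> A_set S' g"
  then have "(M ^^ n) S' \<le> norm ((g ^^ n) z)" if "n \<ge> 1" for n
    using that by (simp add: A_set_def)
  then show "z \<in> A_set S g"
    using order_trans[OF funpow_M_mono[OF assms]] by (simp add: A_set_def)
qed

lemma funpow_less_Suc:
  assumes "norm ((g ^^ n) z) < (M ^^ n) S"
  shows "norm ((g ^^ Suc n) z) < (M ^^ Suc n) S"
  using norm_less_max_modulus[OF holo not_constant assms] by simp

lemma funpow_less:
  assumes "norm ((g ^^ k) z) < (M ^^ k) S" "k \<le> n"
  shows "norm ((g ^^ n) z) < (M ^^ n) S"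
  using assms(2)
proof (induction rule: dec_induct)
  case base
  show ?case by (rule assms(1))
next
  case (step n)
  then show ?case by (intro funpow_less_Suc)
qed

definition E :: "real \<Rightarrow> nat \<Rightarrow> complex set" where
  "E S n = {z. norm ((g ^^ n) z) \<ge> (M ^^ n) S}"

lemma closed_E: "closed (E S n)"
  unfolding E_def using continuous_on_funpow[OF holo, of UNIV n]
  by (intro closed_Collect_le continuous_intros) auto

text \<open>By the strict maximum principle, an orbit that is below the bound at time
  \<open>k\<close> stays below it at all later times.\<close>

lemma E_antimono:
  assumes "k \<le> n"
  shows "E S n \<subseteq> E S k"
proof
  fix z assume z: "z \<in> E S n"
  then have "\<not> norm ((g ^^ k) z) < (M ^^ k) S"
    using funpow_less[OF _ assms, of z S] by (auto simp: E_def)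
  then show "z \<in> E S k"
    by (simp add: E_def)
qed

text \<open>The definition of \<open>A_set\<close> starts at time 1, while the intersection includes
  time 0; the latter condition follows since the sets \<open>E S n\<close> decrease.\<close>

lemma A_set_eq: "A_set S g = (\<Inter>n. E S n)"
proof -
  have "A_set S g = (\<Inter>n\<in>{1..}. E S n)"
    by (auto simp: A_set_def E_def)
  also have "\<dots> = (\<Inter>n. E S n)"
  proof (intro equalityI INT_greatest)
    show "(\<Inter>n\<in>{1..}. E S n) \<subseteq> E S n" for n
      using E_antimono[of n "Suc n" S] by fastforce
  qed (simp_all add: INT_lower)
  finally show ?thesis .
qed

lemma closed_A_set: "closed (A_set S g)"
  unfolding A_set_eq by (intro closed_INT ballI closed_E)

text \<open>By the maximum principle every component of each \<open>E S n\<close> is unbounded; by compactness this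
  property passes to the decreasing intersection.\<close>

lemma A_set_no_compact_part:
  assumes C: "compact C" "C \<noteq> {}" and D: "closed D" "C \<inter> D = {}"
  shows "A_set S g \<noteq> C \<union> D"
proof
  assume eq: "A_set S g = C \<union> D"
  obtain U V where UV: "open U" "open V" "C \<subseteq> U" "D \<subseteq> V" "U \<inter> V = {}"
    using separation_normal[OF compact_imp_closed[OF C(1)] D] by metis
  obtain B where B: "C \<subseteq> ball 0 B"
    using bounded_subset_ballD[OF compact_imp_bounded[OF C(1)]] by blast
  \<comment> \<open>A bounded neighbourhood of \<open>C\<close> whose frontier avoids both
    \<open>C\<close> and \<open>D\<close>, hence all of \<open>A_set S g\<close>.\<close>
  define W where "W = U \<inter> ball 0 B"
  have W: "open W" "bounded W" "C \<subseteq> W"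
    using UV B by (auto simp: W_def intro: bounded_Int)
  have "frontier W \<inter> D = {}"
  proof -
    have "closure W \<inter> V = {}"
      using UV(2,5) open_Int_closure_eq_empty[of V W] by (auto simp: W_def)
    then show ?thesis
      using UV(4) by (auto simp: frontier_def)
  qed
  moreover have "frontier W \<inter> C = {}"
    using W by (auto simp: frontier_def interior_open)
  ultimately have "frontier W \<inter> (\<Inter>n. E S n) = {}"
    using eq unfolding A_set_eq by blast
  moreover have cpt: "compact (frontier W \<inter> E S n)" for n
    using W(2) closed_E by (intro compact_Int_closed compact_frontier_bounded) auto
  \<comment> \<open>Decreasing compact sets with empty intersection: one of them is already
    empty.\<close>
  have "\<exists>n. frontier W \<inter> E S n = {}"
  proof (rule ccontr)
    assume "\<not> ?thesis"
    then have "\<Inter> (range (\<lambda>n. frontier W \<inter> E S n)) \<noteq> {}"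
      using cpt E_antimono by (intro compact_nest) blast+
    with calculation show False by auto
  qed
  then obtain n where n: "frontier W \<inter> E S n = {}" by blast
  obtain \<xi> where \<xi>: "\<xi> \<in> C" using C(2) by blast
  then have "\<xi> \<in> E S n" using eq unfolding A_set_eq by blast
  \<comment> \<open>The maximum over the compact frontier is attained, so it stays strictly below
    \<open>(M ^^ n) S\<close>; the maximum principle then contradicts
    \<open>\<xi> \<in> E S n\<close>.\<close>
  have "\<exists>B < (M ^^ n) S. \<forall>z\<in>frontier W. norm ((g ^^ n) z) \<le> B"
  proof (cases "frontier W = {}")
    case True
    then show ?thesis by (auto intro: lt_ex)
  next
    case False
    have "continuous_on (frontier W) (\<lambda>z. norm ((g ^^ n) z))"
      by (intro continuous_intros continuous_on_funpow[OF holo])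
    then obtain x where "x \<in> frontier W" "\<forall>z\<in>frontier W. norm ((g ^^ n) z) \<le> norm ((g ^^ n) x)"
      using continuous_attains_sup[OF compact_frontier_bounded[OF W(2)] False] by blast
    with n show ?thesis
      by (intro exI[of _ "norm ((g ^^ n) x)"]) (auto simp: E_def)
  qed
  then obtain B where B: "B < (M ^^ n) S" "\<And>z. z \<in> frontier W \<Longrightarrow> norm ((g ^^ n) z) \<le> B"
    by blast
  have "norm ((g ^^ n) \<xi>) \<le> B"
  proof (rule maximum_modulus_frontier[of "g ^^ n" W])
    show "(g ^^ n) holomorphic_on interior W"
      using holomorphic_on_funpow[OF holo] holomorphic_on_subset by blast
    show "continuous_on (closure W) (g ^^ n)"
      by (rule continuous_on_funpow[OF holo])
  qed (use W \<xi> B(2) in blast)+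
  with \<open>\<xi> \<in> E S n\<close> B(1) show False
    by (auto simp: E_def)
qed


text \<open>In the proof, \<open>W n\<close> is the set of points whose orbit follows the sets \<open>G k\<close> up to time \<open>n\<close>. At a
  frontier point of \<open>W n\<close> the orbit can only leave at time \<open>n\<close> exactly, since by \<open>leave\<close> an earlier exit
  would put the next iterate outside the closure of the next set.\<close>

lemma ex_domain_with_frontier_in_A_set:
  assumes S: "S \<ge> R"
    and G: "\<And>n. open (G n)" "bounded (G 0)" "\<And>n. ball 0 ((M ^^ n) S) \<subseteq> G n"
    and leave: "\<And>n z. z \<in> frontier (G n) \<Longrightarrow> g z \<notin> closure (G (Suc n))"
  shows "\<exists>V. simply_connected_domain V \<and> bounded V \<and> ball 0 S \<subseteq> V \<and> frontier V \<subseteq> A_set S g"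
proof -
  define W where "W n = {z. \<forall>k\<le>n. (g ^^ k) z \<in> G k}" for n
  define K where "K = (\<Inter>n. W n)"
  have W_antimono: "W n \<subseteq> W k" if "k \<le> n" for k n
    using that by (auto simp: W_def)
  have openW: "open (W n)" for n
  proof -
    have "open ((g ^^ k) -` G k)" for k
      using continuous_on_open_vimage[OF open_UNIV, of "g ^^ k"] continuous_on_funpow[OF holo] G(1)
      by simp
    then have "open (\<Inter>k\<in>{..n}. (g ^^ k) -` G k)"
      by (intro open_INT) auto
    also have "(\<Inter>k\<in>{..n}. (g ^^ k) -` G k) = W n"
      by (auto simp: W_def)
    finally show ?thesis .
  qed
  have frontier_W: "frontier (W n) \<subseteq> E S n" for n
  proof
    fix z assume z: "z \<in> frontier (W n)"
    have clos: "(g ^^ k) z \<in> closure (G k)" if "k \<le> n" for k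
    proof -
      have "closed ((g ^^ k) -` closure (G k))"
        using continuous_on_closed_vimage[OF closed_UNIV, of "g ^^ k"] continuous_on_funpow[OF holo]
        by simp
      moreover have "W n \<subseteq> (g ^^ k) -` closure (G k)"
        using that closure_subset by (force simp: W_def)
      ultimately have "closure (W n) \<subseteq> (g ^^ k) -` closure (G k)"
        by (rule closure_minimal[rotated])
      with z show ?thesis by (auto simp: frontier_def)
    qed
    have "z \<notin> W n"
      using z openW by (simp add: frontier_def interior_open)
    then obtain k where k: "k \<le> n" "(g ^^ k) z \<notin> G k"
      by (auto simp: W_def)
    have "k = n"
    proof (rule ccontr)
      assume "k \<noteq> n"
      with k(1) have "Suc k \<le> n" by simp
      have "(g ^^ k) z \<in> frontier (G k)"
        using clos[OF k(1)] k(2) G(1) by (simp add: frontier_def interior_open)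
      from leave[OF this] clos[OF \<open>Suc k \<le> n\<close>] show False by simp
    qed
    with k(2) G(3)[of n] have "(g ^^ n) z \<notin> ball 0 ((M ^^ n) S)" by blast
    then show "z \<in> E S n" by (simp add: E_def)
  qed
  have frontier_K: "frontier K \<subseteq> A_set S g"
  proof
    fix z assume z: "z \<in> frontier K"
    have "z \<in> E S N" for N
    proof -
      \<comment> \<open>A ball about \<open>z\<close> meets \<open>K\<close> and its complement. For
        large \<open>l\<close> it meets \<open>W l\<close> and its complement, so being connected it
        meets the frontier of \<open>W l\<close>, which lies in \<open>E S l\<close>.\<close>
      have "\<exists>p\<in>E S N. dist p z < e" if e: "e > 0" for e
      proof -
        obtain x y where x: "x \<in> K" "dist x z < e" and y: "y \<notin> K" "dist y z < e"
          using z e unfolding frontier_straddle by (metis dist_commute)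
        from y(1) obtain n where n: "y \<notin> W n" by (auto simp: K_def)
        define l where "l = max n N"
        have "y \<notin> W l" "x \<in> W l"
          using n x(1) W_antimono[of n l] by (auto simp: K_def l_def)
        moreover have ball: "x \<in> ball z e" "y \<in> ball z e"
          using x(2) y(2) by (simp_all add: dist_commute)
        ultimately have "ball z e \<inter> frontier (W l) \<noteq> {}"
          using ball by (intro connected_Int_frontier connected_ball) blast+
        then obtain p where "p \<in> ball z e" "p \<in> frontier (W l)" by blast
        with frontier_W[of l] E_antimono[of N l S] show ?thesis
          by (intro bexI[of _ p]) (auto simp: l_def dist_commute)
      qed
      then have "z \<in> closure (E S N)"
        by (simp add: closure_approachable)
      then show ?thesis
        by (simp add: closed_E)
    qed
    then show "z \<in> A_set S g" by (simp add: A_set_eq)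
  qed
  \<comment> \<open>\<open>K\<close> need be neither open nor connected. Passing to its interior and
    then to the component of 0 adds no frontier points outside \<open>frontier K\<close>.\<close>
  define H where "H = connected_component_set (interior K) 0"
  have "ball 0 S \<subseteq> K"
  proof
    fix z :: complex assume "z \<in> ball 0 S"
    then have "(g ^^ k) z \<in> ball 0 ((M ^^ k) S)" for k
      using funpow_less[of 0 z S k] by simp
    with G(3) have "(g ^^ k) z \<in> G k" for k
      by blast
    then show "z \<in> K"
      by (simp add: K_def W_def)
  qed
  then have "ball 0 S \<subseteq> interior K"
    by (simp add: interior_maximal)
  then have ball_H: "ball 0 S \<subseteq> H"
    unfolding H_def using S R_pos by (intro connected_component_maximal) auto
  have H: "open H" "connected H"
    by (simp_all add: H_def open_connected_component)
  have "H \<subseteq> K"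
    using connected_component_subset interior_subset unfolding H_def by blast
  also have "K \<subseteq> W 0"
    by (auto simp: K_def)
  also have "W 0 \<subseteq> G 0"
    by (auto simp: W_def)
  finally have bounded_H: "bounded H"
    using G(2) bounded_subset by blast
  have "frontier H \<subseteq> frontier (interior K)"
    unfolding H_def by (rule frontier_of_connected_component_subset)
  also have "\<dots> \<subseteq> frontier K"
    by (rule frontier_interior_subset)
  also note frontier_K
  finally have frontier_H: "frontier H \<subseteq> A_set S g" .
  have "0 \<in> ball (0 :: complex) S"
    using S R_pos by simp
  with ball_H have "H \<noteq> {}"
    by blast
  from ex_simply_connected_filling[OF H bounded_H this]
  obtain V where "simply_connected_domain V" "bounded V" "H \<subseteq> V" "frontier V \<subseteq> frontier H"
    by blast
  with ball_H frontier_H show ?thesis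
    by (intro exI[of _ V]) (simp add: subset_trans)
qed

text \<open>If \<open>A_set R g\<close> split into two closed parts, a domain containing points of
  both would have its connected frontier in one of them, and the other part inside the domain would
  be cut off. The exhausting sequence comes from choosing each radius beyond the preceding
  domain.\<close>

lemma spiders_web_if_domains:
  assumes dom: "\<And>S. S \<ge> S0 \<Longrightarrow> \<exists>V. simply_connected_domain V \<and> bounded V \<and>
      ball 0 S \<subseteq> V \<and> frontier V \<subseteq> A_set R g"
  shows "spiders_web (A_set R g)"
  unfolding spiders_web_def
proof
  obtain v where v: "\<And>S. S \<ge> S0 \<Longrightarrow> simply_connected_domain (v S)"
      "\<And>S. S \<ge> S0 \<Longrightarrow> bounded (v S)" "\<And>S. S \<ge> S0 \<Longrightarrow> ball 0 S \<subseteq> v S"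
      "\<And>S. S \<ge> S0 \<Longrightarrow> frontier (v S) \<subseteq> A_set R g"
    using dom by metis
  have no_separation: False
    if AB: "closed A" "closed B" "A_set R g \<subseteq> A \<union> B" "A \<inter> B \<inter> A_set R g = {}"
      and V: "bounded V" "open V" "frontier V \<subseteq> A_set R g" "frontier V \<subseteq> A" "b \<in> V" "b \<in> B" "b \<in> A_set R g"
    for A B V b
  proof (rule notE[OF A_set_no_compact_part])
    \<comment> \<open>Since \<open>frontier V\<close> lies in \<open>A\<close>, the set
      \<open>?C\<close> stays inside \<open>V\<close>, so it is compact and disjoint from
      \<open>?D\<close>; the latter is closed because \<open>V\<close> is open.\<close>
    let ?C = "closure V \<inter> (B \<inter> A_set R g)" and ?D = "A_set R g \<inter> (A \<union> - V)"
    have frontier: "closure V = V \<union> frontier V"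
      by (rule closure_Un_frontier)
    show "compact ?C" "closed ?D"
      using AB V closed_A_set by (auto intro!: compact_Int_closed closed_Int closed_Un)
    show "?C \<noteq> {}" "?C \<inter> ?D = {}" "A_set R g = ?C \<union> ?D"
      using AB V unfolding frontier by blast+
  qed
  show "connected (A_set R g)"
    unfolding connected_closed
  proof (rule notI, elim exE conjE)
    fix A B assume AB: "closed A" "closed B" "A_set R g \<subseteq> A \<union> B" "A \<inter> B \<inter> A_set R g = {}"
      "A \<inter> A_set R g \<noteq> {}" "B \<inter> A_set R g \<noteq> {}"
    then obtain a b where a: "a \<in> A" "a \<in> A_set R g" and b: "b \<in> B" "b \<in> A_set R g"
      by blast
    define S where "S = max S0 (max (norm a) (norm b) + 1)"
    define V where "V = v S"
    have S: "S \<ge> S0" "norm a < S" "norm b < S"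
      by (auto simp: S_def)
    have V: "open V" "simply_connected V" "bounded V" "frontier V \<subseteq> A_set R g" "a \<in> V" "b \<in> V"
      using v[OF S(1)] S by (auto simp: V_def simply_connected_domain_def)
    then have "connected (frontier V)"
      using simply_connected_eq_frontier_properties[of V] by simp
    then have "A \<inter> frontier V = {} \<or> B \<inter> frontier V = {}"
      by (rule connected_closedD) (use AB V(4) in blast)+
    then have "frontier V \<subseteq> A \<or> frontier V \<subseteq> B"
      using AB(3) V(4) by blast
    then show False
      using no_separation[OF AB(1-4) V(3,1,4) _ V(6) b]
        no_separation[OF AB(2,1) _ _ V(3,1,4) _ V(5) a] AB(3,4) by (auto simp: Un_commute Int_commute)
  qed
  have "\<exists>b. v S \<subseteq> ball 0 b" if "S \<ge> S0" for S
    using bounded_subset_ballD[OF v(2)[OF that]] by blast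
  then obtain b where b: "\<And>S. S \<ge> S0 \<Longrightarrow> v S \<subseteq> ball 0 (b S)"
    by metis
  \<comment> \<open>The term \<open>b t\<close> makes the next disc contain the present domain;
    \<open>t + 1\<close> drives the radii to infinity.\<close>
  define s where "s n = ((\<lambda>t. max (t + 1) (b t)) ^^ n) (max 0 S0)" for n :: nat
  have s_ge: "s n \<ge> S0 + real n" for n
    by (induction n) (auto simp: s_def)
  have s0: "s n \<ge> S0" for n
    using s_ge[of n] by simp
  show "\<exists>G. (\<forall>n. bounded (G n) \<and> simply_connected_domain (G n) \<and> G n \<subseteq> G (Suc n) \<and>
      frontier (G n) \<subseteq> A_set R g) \<and> (\<Union>n. G n) = UNIV"
  proof (intro exI[of _ "\<lambda>n. v (s n)"] conjI allI)
    fix n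
    show "bounded (v (s n))" "simply_connected_domain (v (s n))" "frontier (v (s n)) \<subseteq> A_set R g"
      using v s0 by auto
    have "v (s n) \<subseteq> ball 0 (b (s n))"
      by (rule b[OF s0])
    also have "\<dots> \<subseteq> ball 0 (s (Suc n))"
      by (intro subset_ball) (simp add: s_def)
    also have "\<dots> \<subseteq> v (s (Suc n))"
      by (rule v(3)[OF s0])
    finally show "v (s n) \<subseteq> v (s (Suc n))" .
  next
    show "(\<Union>n. v (s n)) = UNIV"
    proof (intro equalityI subsetI UNIV_I)
      fix z :: complex
      obtain n where "norm z - S0 < real n"
        using reals_Archimedean2 by blast
      with s_ge[of n] have "z \<in> ball 0 (s n)" by simp
      with v(3)[OF s0] show "z \<in> (\<Union>n. v (s n))" by blast
    qed
  qed
qed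

text \<open>The strict bound puts \<open>g z\<close> outside the closed disc of radius
  \<open>b (M S)\<close>, hence outside the closure of the domain for radius \<open>M S\<close>. So
  the domains for the radii \<open>(M ^^ n) S\<close> satisfy the exit condition
  \<open>leave\<close>.\<close>

lemma spiders_web_criterion:
  assumes "\<And>S. S \<ge> S0 \<Longrightarrow> \<exists>G. open G \<and> ball 0 S \<subseteq> G \<and> G \<subseteq> ball 0 (b S) \<and>
      (\<forall>z\<in>frontier G. norm (g z) > b (M S))"
  shows "spiders_web (A_set R g)"
proof (rule spiders_web_if_domains[where ?S0.0 = "max R S0"])
  fix S assume S: "S \<ge> max R S0"
  obtain G where G: "\<And>S. S \<ge> S0 \<Longrightarrow> open (G S)" "\<And>S. S \<ge> S0 \<Longrightarrow> ball 0 S \<subseteq> G S"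
      "\<And>S. S \<ge> S0 \<Longrightarrow> G S \<subseteq> ball 0 (b S)"
      "\<And>S z. S \<ge> S0 \<Longrightarrow> z \<in> frontier (G S) \<Longrightarrow> norm (g z) > b (M S)"
    using assms by metis
  have ge: "(M ^^ n) S \<ge> S0" for n
    using funpow_M_ge[of S n] S by simp
  have "\<exists>V. simply_connected_domain V \<and> bounded V \<and> ball 0 S \<subseteq> V \<and> frontier V \<subseteq> A_set S g"
  proof (rule ex_domain_with_frontier_in_A_set[where G = "\<lambda>n. G ((M ^^ n) S)"])
    show "g z \<notin> closure (G ((M ^^ Suc n) S))" if "z \<in> frontier (G ((M ^^ n) S))" for n z
    proof -
      have "closure (G ((M ^^ Suc n) S)) \<subseteq> cball 0 (b ((M ^^ Suc n) S))"
        using G(3)[OF ge[of "Suc n"]] ball_subset_cball by (intro closure_minimal) blast+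
      with G(4)[OF ge that] show ?thesis by auto
    qed
    show "bounded (G ((M ^^ 0) S))"
      using G(3)[OF ge[of 0]] bounded_subset by blast
  qed (use S G ge in auto)
  with A_set_antimono[of R S] S
  show "\<exists>V. simply_connected_domain V \<and> bounded V \<and> ball 0 S \<subseteq> V \<and> frontier V \<subseteq> A_set R g"
    by (meson max.boundedE order_refl subset_trans)
qed

end

subsection \<open>Growth of log-regular functions\<close>

text \<open>With only one-sided derivatives at hand, the mean value theorem is replaced by a
  supremum argument that allows \<open>h\<close> to decrease at rate at most
  \<open>\<epsilon>\<close>. The assumption \<open>left\<close> excludes downward jumps.\<close>

lemma le_if_right_derivative_nonneg:
  fixes h :: "real \<Rightarrow> real"
  assumes "a \<le> b"
    and right: "\<And>t. a \<le> t \<Longrightarrow> t < b \<Longrightarrow> \<exists>D\<ge>0. (h has_real_derivative D) (at_right t)"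
    and left: "\<And>t e. a < t \<Longrightarrow> t \<le> b \<Longrightarrow> e > 0 \<Longrightarrow> \<forall>\<^sub>F s in at_left t. h s \<le> h t + e"
  shows "h a \<le> h b"
proof (rule field_le_epsilon)
  fix \<delta> :: real assume "\<delta> > 0"
  \<comment> \<open>The total loss over the interval is then at most \<open>\<delta>\<close>; adding
    1 keeps the denominator positive if \<open>a = b\<close>.\<close>
  define \<epsilon> where "\<epsilon> = \<delta> / (b - a + 1)"
  have \<epsilon>: "\<epsilon> > 0" "\<epsilon> * (b - a) \<le> \<delta>"
    using \<open>\<delta> > 0\<close> assms(1) by (auto simp: \<epsilon>_def field_simps)
  define A where "A = {t \<in> {a..b}. h a \<le> h t + \<epsilon> * (t - a)}"
  have A: "a \<in> A" "bdd_above A" "A \<subseteq> {a..b}"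
    using assms(1) by (auto simp: A_def)
  define s where "s = Sup A"
  have s: "a \<le> s" "s \<le> b"
    using cSup_upper[OF A(1,2)] cSup_least[of A b] A(1,3) unfolding s_def by (auto simp: subset_eq)
  have "s \<in> A"
  proof (rule ccontr)
    assume "s \<notin> A"
    with A(1) s have "a < s" by (cases "a = s") auto
    \<comment> \<open>Points of \<open>A\<close> approach \<open>s\<close> from the left, and
      \<open>left\<close> passes their inequality on to \<open>s\<close> up to
      \<open>e\<close>.\<close>
    have "h a \<le> h s + \<epsilon> * (s - a) + e" if e: "e > 0" for e
    proof -
      obtain l where l: "l < s" "\<And>t. l < t \<Longrightarrow> t < s \<Longrightarrow> h t \<le> h s + e"
        using left[OF \<open>a < s\<close> s(2) e] unfolding eventually_at_left_field by blast
      obtain t where t: "t \<in> A" "l < t"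
        using less_cSupD[of A l] l(1) A(1) unfolding s_def by blast
      have "t \<le> s"
        unfolding s_def using t A(2) by (intro cSup_upper)
      with t \<open>s \<notin> A\<close> have "t < s" by (cases "t = s") auto
      have "h a \<le> h t + \<epsilon> * (t - a)"
        using t(1) by (simp add: A_def)
      also have "\<epsilon> * (t - a) \<le> \<epsilon> * (s - a)"
        using \<open>t < s\<close> \<epsilon>(1) by simp
      also note l(2)[OF t(2) \<open>t < s\<close>]
      finally show ?thesis by simp
    qed
    then have "h a \<le> h s + \<epsilon> * (s - a)"
      by (rule field_le_epsilon)
    with s \<open>s \<notin> A\<close> show False by (simp add: A_def)
  qed
  \<comment> \<open>Otherwise the difference quotients to the right of \<open>s\<close> eventually
    exceed \<open>- \<epsilon>\<close>, which yields a point of \<open>A\<close> beyond its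
    supremum.\<close>
  have "s = b"
  proof (rule ccontr)
    assume "s \<noteq> b"
    with s have "s < b" by simp
    then obtain D where D: "D \<ge> 0" "(h has_real_derivative D) (at_right s)"
      using right s(1) by blast
    then have "((\<lambda>y. (h y - h s) / (y - s)) \<longlongrightarrow> D) (at_right s)"
      by (simp add: has_field_derivative_iff)
    then have "\<forall>\<^sub>F y in at_right s. - \<epsilon> < (h y - h s) / (y - s)"
      using D(1) \<epsilon>(1) by (intro order_tendstoD(1)[where y = D]) auto
    moreover have "\<forall>\<^sub>F y in at_right s. y \<in> {s<..<b}"
      using eventually_at_right_real[OF \<open>s < b\<close>] .
    ultimately have "\<forall>\<^sub>F y in at_right s. - \<epsilon> < (h y - h s) / (y - s) \<and> y \<in> {s<..<b}"
      by (rule eventually_conj)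
    then obtain y where y: "- \<epsilon> < (h y - h s) / (y - s)" "s < y" "y < b"
      using eventually_happens[of _ "at_right s"] by auto
    then have "- \<epsilon> * (y - s) < h y - h s"
      by (simp add: pos_less_divide_eq)
    moreover have "h a \<le> h s + \<epsilon> * (s - a)"
      using \<open>s \<in> A\<close> by (simp add: A_def)
    ultimately have "y \<in> A"
      using y s by (simp add: A_def algebra_simps)
    then have "y \<le> s"
      unfolding s_def using A(2) by (intro cSup_upper)
    with y show False by simp
  qed
  with \<open>s \<in> A\<close> have "h a \<le> h b + \<epsilon> * (b - a)"
    by (simp add: A_def)
  with \<epsilon>(2) show "h a \<le> h b + \<delta>"
    by simp
qed

text \<open>Log-regularity says that \<open>ln (\<phi> t) - (1 + c) * ln t\<close> has nonnegative
  right derivative for large \<open>t\<close>. It is therefore nondecreasing, and comparing its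
  values at \<open>t\<close> and \<open>k * t\<close> gives the claim.\<close>

lemma log_regular_scaling:
  assumes reg: "log_regular_with c f" and c: "c > 0"
  obtains T where "T > 0" "\<And>t. t \<ge> T \<Longrightarrow> max_modulus f (exp t) > 0"
    "\<And>t. t \<ge> T \<Longrightarrow> log_max_modulus f t > 0"
    "\<And>t k. t \<ge> T \<Longrightarrow> k \<ge> 1 \<Longrightarrow> log_max_modulus f (k * t) \<ge> k powr (1 + c) * log_max_modulus f t"
proof -
  let ?\<phi> = "log_max_modulus f"
  have holo: "f holomorphic_on UNIV" and np: "\<not> (\<exists>p. \<forall>z. f z = poly p z)"
    using reg by (auto simp: log_regular_with_def transcendental_entire_def)
  obtain z0 where z0: "f z0 \<noteq> 0"
    using np by (metis poly_0)
  obtain T0 where T0: "\<And>t. t \<ge> T0 \<Longrightarrow> \<exists>D. (?\<phi> has_real_derivative D) (at_right t) \<and> D / ?\<phi> t \<ge> (1 + c) / t"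
    using reg unfolding log_regular_with_def eventually_at_top_linorder by blast
  \<comment> \<open>The last term places \<open>z0\<close>, where \<open>f\<close> does not vanish,
    inside the disc of radius \<open>exp t\<close>, so the logarithm is taken of a positive
    number.\<close>
  define T where "T = max (max T0 1) (ln (norm z0 + 1))"
  have T: "T > 0" "T \<ge> T0"
    by (auto simp: T_def)
  have pos: "max_modulus f (exp t) > 0" if "t \<ge> T" for t
  proof -
    have "norm z0 + 1 = exp (ln (norm z0 + 1))"
      by (simp add: add_nonneg_pos)
    also have "\<dots> \<le> exp t"
      using that by (simp add: T_def)
    finally have "norm (f z0) \<le> max_modulus f (exp t)"
      by (intro norm_le_max_modulus holo) simp
    with z0 show ?thesis
      by (smt (verit) zero_less_norm_iff)
  qed
  have mono: "?\<phi> s \<le> ?\<phi> t" if "T \<le> s" "s \<le> t" for s t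
    unfolding log_max_modulus_def using that pos[of s] pos[of t]
    by (auto intro!: max_modulus_mono holo)
  \<comment> \<open>Monotonicity gives \<open>D \<ge> 0\<close>, and the quotient is positive by
    log-regularity; together these force \<open>?\<phi> t > 0\<close>, since division by 0 yields
    0.\<close>
  have deriv: "?\<phi> t > 0 \<and> (\<exists>D. (?\<phi> has_real_derivative D) (at_right t) \<and> D / ?\<phi> t \<ge> (1 + c) / t)"
    if t: "t \<ge> T" for t
  proof -
    obtain D where D: "(?\<phi> has_real_derivative D) (at_right t)" "D / ?\<phi> t \<ge> (1 + c) / t"
      using T0[of t] t T by auto
    then have "((\<lambda>y. (?\<phi> y - ?\<phi> t) / (y - t)) \<longlongrightarrow> D) (at_right t)"
      by (simp add: has_field_derivative_iff)
    moreover have "\<forall>\<^sub>F y in at_right t. 0 \<le> (?\<phi> y - ?\<phi> t) / (y - t)"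
      using eventually_at_right_less[of t] by eventually_elim (use mono[OF t] in simp)
    ultimately have "D \<ge> 0"
      by (rule tendsto_lowerbound) simp
    have "(1 + c) / t > 0"
      using c t T by simp
    with D(2) have "D / ?\<phi> t > 0" by linarith
    with \<open>D \<ge> 0\<close> have "?\<phi> t > 0"
      by (simp add: zero_less_divide_iff)
    with D show ?thesis by blast
  qed
  define h where "h t = ln (?\<phi> t) - (1 + c) * ln t" for t
  have h_mono: "h s \<le> h t" if st: "T \<le> s" "s \<le> t" for s t
  proof (rule le_if_right_derivative_nonneg[OF st(2)])
    fix u assume u: "s \<le> u" "u < t"
    obtain D where D: "?\<phi> u > 0" "(?\<phi> has_real_derivative D) (at_right u)" "D / ?\<phi> u \<ge> (1 + c) / u"
      using deriv[of u] u st by auto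
    have "((\<lambda>x. ln (?\<phi> x)) has_real_derivative D / ?\<phi> u) (at_right u)"
      using DERIV_ln_divide[OF D(1)] D(2) DERIV_chain2 by fastforce
    moreover have "(ln has_real_derivative 1 / u) (at_right u)"
      using DERIV_ln_divide[of u] u st T by (auto intro: has_field_derivative_at_within)
    ultimately have "(h has_real_derivative D / ?\<phi> u - (1 + c) * (1 / u)) (at_right u)"
      unfolding h_def by (intro DERIV_diff DERIV_cmult)
    with D(3) show "\<exists>D\<ge>0. (h has_real_derivative D) (at_right u)"
      by (intro exI[of _ "D / ?\<phi> u - (1 + c) * (1 / u)"]) simp
  next
    fix u e :: real assume u: "s < u" "u \<le> t" "e > 0"
    \<comment> \<open>Only the explicit logarithm needs continuity; monotonicity of
      \<open>?\<phi>\<close> bounds the other term by its value at \<open>u\<close>.\<close>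
    have "((\<lambda>v. ln (?\<phi> u) - (1 + c) * ln v) \<longlongrightarrow> h u) (at_left u)"
      unfolding h_def using u st T by (intro tendsto_intros) auto
    then have "\<forall>\<^sub>F v in at_left u. ln (?\<phi> u) - (1 + c) * ln v < h u + e"
      using u by (intro order_tendstoD(2)[where y = "h u"]) auto
    moreover have "\<forall>\<^sub>F v in at_left u. v \<in> {s<..<u}"
      using eventually_at_left_real[OF u(1)] .
    ultimately show "\<forall>\<^sub>F v in at_left u. h v \<le> h u + e"
    proof eventually_elim
      case (elim v)
      then have "ln (?\<phi> v) \<le> ln (?\<phi> u)"
        using mono[of v u] deriv[of v] st by simp
      with elim show ?case by (simp add: h_def)
    qed
  qed
  have "k powr (1 + c) * ?\<phi> t \<le> ?\<phi> (k * t)" if t: "t \<ge> T" and k: "k \<ge> 1" for t k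
  proof -
    have le: "t \<le> k * t"
      using t k T by simp
    then have pos: "?\<phi> t > 0" "?\<phi> (k * t) > 0"
      using deriv[of t] deriv[of "k * t"] t by auto
    have "h t \<le> h (k * t)"
      using h_mono t le by blast
    then have "ln (?\<phi> t) + (1 + c) * ln k \<le> ln (?\<phi> (k * t))"
      using t k T by (simp add: h_def ln_mult algebra_simps)
    also have "ln (?\<phi> t) + (1 + c) * ln k = ln (k powr (1 + c) * ?\<phi> t)"
      using pos k by (simp add: ln_mult ln_powr)
    finally show ?thesis
      using pos k by simp
  qed
  with T(1) pos deriv show thesis
    by (intro that[of T]) auto
qed

text \<open>Both growth claims use \<open>k powr (1 + c) = k * k powr c\<close>, where the last
  factor exceeds any prescribed constant for large \<open>k\<close>.\<close>

lemma log_regular_growth: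
  assumes "log_regular f"
  obtains r0 where "r0 > 1" "\<And>r. r \<ge> r0 \<Longrightarrow> max_modulus f r > 1"
    "\<And>J :: nat. \<exists>k\<ge>1. \<forall>r\<ge>r0. max_modulus f (r ^ k) \<ge> max_modulus f r ^ (k * J)"
    "\<And>N :: nat. \<forall>\<^sub>F r in at_top. max_modulus f r \<ge> r ^ N"
proof -
  obtain c where c: "c > 0" "log_regular_with c f"
    using assms by (auto simp: log_regular_def)
  obtain T where T: "T > 0" "\<And>t. t \<ge> T \<Longrightarrow> max_modulus f (exp t) > 0"
    "\<And>t. t \<ge> T \<Longrightarrow> log_max_modulus f t > 0"
    "\<And>t k. t \<ge> T \<Longrightarrow> k \<ge> 1 \<Longrightarrow> log_max_modulus f (k * t) \<ge> k powr (1 + c) * log_max_modulus f t"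
    using log_regular_scaling[OF c(2,1)] by metis
  have exp_log: "max_modulus f (exp t) = exp (log_max_modulus f t)" if "t \<ge> T" for t
    using T(2)[OF that] by (simp add: log_max_modulus_def)
  have large: "\<exists>k0\<ge>1. \<forall>k\<ge>k0. k powr c \<ge> x" for x :: real
  proof (intro exI[of _ "max 1 (\<bar>x\<bar> powr (1 / c))"] conjI allI impI)
    fix k assume "k \<ge> max 1 (\<bar>x\<bar> powr (1 / c))"
    then have "(\<bar>x\<bar> powr (1 / c)) powr c \<le> k powr c"
      using c(1) by (intro powr_mono2) auto
    then show "x \<le> k powr c"
      using c(1) by (simp add: powr_powr)
  qed simp
  show thesis
  proof (rule that[of "exp T"])
    show "exp T > 1" using T(1) by simp
  next
    fix r assume "r \<ge> exp T"
    with less_le_trans[OF exp_gt_zero this] have "ln r \<ge> T" "r = exp (ln r)"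
      by (simp_all add: ln_ge_iff)
    then show "max_modulus f r > 1"
      using exp_log[of "ln r"] T(3)[of "ln r"] by simp
  next
    fix J :: nat
    obtain k0 where k0: "k0 \<ge> 1" "\<And>k. k \<ge> k0 \<Longrightarrow> k powr c \<ge> real J"
      using large[of "real J"] by blast
    obtain k :: nat where "k0 \<le> real k"
      using real_arch_simple by blast
    then have k: "k \<ge> 1" "real k powr c \<ge> real J"
      using k0 by auto
    show "\<exists>k\<ge>1. \<forall>r\<ge>exp T. max_modulus f (r ^ k) \<ge> max_modulus f r ^ (k * J)"
    proof (intro exI[of _ k] conjI allI impI k)
      fix r assume r: "r \<ge> exp T"
      define t where "t = ln r"
      have t: "t \<ge> T" and r_eq: "r = exp t"
        using r less_le_trans[OF exp_gt_zero r] by (simp_all add: t_def ln_ge_iff)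
      have kt: "real k * t \<ge> T"
        using t k(1) T(1) mult_mono[of 1 "real k" T t] by simp
      have "max_modulus f r ^ (k * J) = exp (real k * real J * log_max_modulus f t)"
        unfolding r_eq exp_log[OF t] by (simp flip: exp_of_nat_mult)
      also have "\<dots> \<le> exp (real k powr (1 + c) * log_max_modulus f t)"
        using k T(3)[OF t] by (simp add: powr_add)
      also have "\<dots> \<le> exp (log_max_modulus f (real k * t))"
        using T(4)[OF t, of "real k"] k(1) by simp
      also have "\<dots> = max_modulus f (r ^ k)"
        unfolding r_eq by (simp add: exp_log[OF kt] flip: exp_of_nat_mult)
      finally show "max_modulus f r ^ (k * J) \<le> max_modulus f (r ^ k)" .
    qed
  next
    fix N :: nat
    obtain k0 where k0: "k0 \<ge> 1" "\<And>k. k \<ge> k0 \<Longrightarrow> k powr c \<ge> real N * T / log_max_modulus f T"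
      using large by blast
    have "r ^ N \<le> max_modulus f r" if r: "r \<ge> exp (k0 * T)" for r
    proof -
      \<comment> \<open>Here \<open>k\<close> is real: every large radius is compared with the fixed
        radius \<open>exp T\<close>.\<close>
      define k where "k = ln r / T"
      have "k0 * T \<le> ln r"
        using r less_le_trans[OF exp_gt_zero r] by (simp add: ln_ge_iff)
      then have "k \<ge> k0" "r = exp (k * T)"
        using T(1) less_le_trans[OF exp_gt_zero r] by (simp_all add: k_def field_simps)
      with k0(1) have k: "k \<ge> k0" "k \<ge> 1" "r = exp (k * T)"
        by auto
      have kT: "k * T \<ge> T"
        using k T(1) by simp
      have "real N * T \<le> k powr c * log_max_modulus f T"
        using k0(2)[OF k(1)] T(3)[of T] by (simp add: field_simps)
      then have "k * (real N * T) \<le> k * (k powr c * log_max_modulus f T)"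
        using k(2) by (intro mult_left_mono) auto
      also have "\<dots> = k powr (1 + c) * log_max_modulus f T"
        using k(2) by (simp add: powr_add)
      also have "\<dots> \<le> log_max_modulus f (k * T)"
        using T(4)[of T k] k(2) by simp
      finally have "exp (real N * (k * T)) \<le> exp (log_max_modulus f (k * T))"
        by (simp add: mult_ac)
      then show ?thesis
        unfolding k(3) exp_log[OF kT] by (simp add: exp_of_nat_mult)
    qed
    then show "\<forall>\<^sub>F r in at_top. r ^ N \<le> max_modulus f r"
      unfolding eventually_at_top_linorder by blast
  qed
qed

subsection \<open>Bounds for polynomials\<close>

text \<open>Each coefficient costs two powers of \<open>r\<close>: one for the factor
  \<open>z\<close>, one to absorb the sum. All larger exponents are included so that they can be
  adjusted later.\<close>

lemma poly_upper_bound: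
  fixes p :: "complex poly"
  shows "\<exists>N. \<forall>n\<ge>N. \<forall>\<^sub>F r in at_top. \<forall>z. norm z \<le> r \<longrightarrow> norm (poly p z) < r ^ n"
proof (induction p)
  case 0
  show ?case
    by (auto intro!: exI[of _ 0] eventually_mono[OF eventually_gt_at_top[of 0]])
next
  case (pCons a p)
  then obtain N where N: "\<forall>\<^sub>F r in at_top. \<forall>z. norm z \<le> r \<longrightarrow> norm (poly p z) < r ^ N"
    by blast
  have "\<forall>\<^sub>F r in at_top. \<forall>z. norm z \<le> r \<longrightarrow> norm (poly (pCons a p) z) < r ^ n" if n: "n \<ge> N + 2" for n
    using N eventually_ge_at_top[of 2] eventually_ge_at_top[of "norm a"]
  proof eventually_elim
    case (elim r)
    show ?case
    proof (intro allI impI)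
      fix z :: complex assume z: "norm z \<le> r"
      have "norm (poly (pCons a p) z) \<le> norm a + norm z * norm (poly p z)"
        by (simp add: norm_mult[symmetric] norm_triangle_ineq)
      also have "norm z * norm (poly p z) \<le> r * norm (poly p z)"
        using z by (intro mult_right_mono) auto
      also have "r * norm (poly p z) < r * r ^ N"
        using elim z by (intro mult_strict_left_mono) auto
      also have "norm a + r * r ^ N \<le> r * r ^ N + r * r ^ N"
        using elim order_trans[OF elim(3) self_le_power[of r "Suc N"]] by simp
      also have "\<dots> = 2 * (r * r ^ N)"
        by simp
      also have "\<dots> \<le> r * (r * r ^ N)"
        using elim by (intro mult_right_mono) auto
      also have "\<dots> = r ^ (N + 2)"
        by simp
      also have "\<dots> \<le> r ^ n"
        using elim n by (intro power_increasing) auto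
      finally show "norm (poly (pCons a p) z) < r ^ n"
        by simp
    qed
  qed
  then show ?case by blast
qed

lemma poly_upper_bound_at_infinity:
  fixes p :: "complex poly"
  shows "\<exists>N. \<forall>\<^sub>F z in at_infinity. norm (poly p z) < norm z ^ N"
proof -
  obtain N where "\<forall>\<^sub>F r in at_top. \<forall>z. norm z \<le> r \<longrightarrow> norm (poly p z) < r ^ N"
    using poly_upper_bound by blast
  then have "\<forall>\<^sub>F z in at_infinity. \<forall>y. norm y \<le> norm z \<longrightarrow> norm (poly p y) < norm (z :: complex) ^ N"
    by (rule eventually_compose_filterlim[OF _ filterlim_norm_at_top])
  then show ?thesis
    by (blast intro: eventually_mono)
qed

lemma eventually_norm_ge_at_infinity: "\<forall>\<^sub>F z in at_infinity. norm z \<ge> K"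
  by (auto simp: eventually_at_infinity)

lemma poly_lower_bound:
  fixes p :: "complex poly"
  assumes "p \<noteq> 0"
  shows "\<exists>c>0. \<forall>\<^sub>F z in at_infinity. c \<le> norm (poly p z)"
proof (cases p)
  case (pCons a q)
  show ?thesis
  proof (cases "q = 0")
    case True
    with pCons assms show ?thesis
      by (intro exI[of _ "norm a"]) auto
  next
    case False
    from poly_infinity[OF this, of 1 a] pCons show ?thesis
      by (intro exI[of _ 1]) (auto simp: eventually_at_infinity)
  qed
qed

text \<open>Near infinity \<open>|Q(z)|\<close> is at least a constant multiple of
  \<open>|z|\<close>; squaring absorbs the constant.\<close>

lemma norm_le_power2_poly:
  fixes Q :: "complex poly"
  assumes "degree Q \<ge> 1"
  shows "\<forall>\<^sub>F z in at_infinity. norm z \<le> norm (poly Q z) ^ 2"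
proof (cases Q)
  case (pCons a q)
  with assms have "q \<noteq> 0" by auto
  then obtain c where c: "c > 0" "\<forall>\<^sub>F z in at_infinity. c \<le> norm (poly q z)"
    using poly_lower_bound by blast
  show ?thesis
    using c(2) eventually_norm_ge_at_infinity[of "2 * norm a / c"]
      eventually_norm_ge_at_infinity[of "4 / c ^ 2"]
  proof eventually_elim
    case (elim z)
    have "c / 2 * norm z \<le> c * norm z - norm a"
      using elim c(1) by (simp add: field_simps)
    also have "\<dots> \<le> norm z * norm (poly q z) - norm a"
      using elim mult_left_mono[of c "norm (poly q z)" "norm z"] by (simp add: mult.commute)
    also have "\<dots> \<le> norm (poly Q z)"
      using norm_triangle_ineq2[of "z * poly q z" "- a"] by (simp add: pCons norm_mult add.commute)
    finally have "(c / 2 * norm z) ^ 2 \<le> norm (poly Q z) ^ 2"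
      using c(1) by (intro power_mono) auto
    moreover have "1 * norm z \<le> (c ^ 2 / 4 * norm z) * norm z"
      using elim c(1) by (intro mult_right_mono) (auto simp: field_simps)
    ultimately show ?case
      by (simp add: power2_eq_square field_simps)
  qed
qed

section \<open>Polynomials in two variables\<close>

lemma eval_poly2_0 [simp]: "eval_poly2 0 w z = 0"
  by (simp add: eval_poly2_def)

lemma eval_poly2_pCons [simp]: "eval_poly2 (pCons p P) w z = poly p z + w * eval_poly2 P w z"
  by (simp add: eval_poly2_def)

lemma holomorphic_on_eval_poly2:
  assumes "h holomorphic_on A"
  shows "(\<lambda>z. eval_poly2 P (h z) z) holomorphic_on A"
  by (induction P) (auto intro!: holomorphic_intros assms)

text \<open>\<open>Y\<close> majorizes both \<open>|w|\<close> and a power of \<open>r\<close>, so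
  the coefficients in \<open>z\<close> can also be bounded by powers of \<open>Y\<close>.\<close>

lemma eval_poly2_upper_bound:
  "\<exists>N. \<forall>n\<ge>N. \<forall>\<^sub>F r in at_top. \<forall>z w Y. norm z \<le> r \<longrightarrow> norm w \<le> Y \<longrightarrow> r ^ n \<le> Y \<longrightarrow>
     norm (eval_poly2 P w z) \<le> Y ^ n"
proof (induction P)
  case 0
  have "0 \<le> Y ^ n" if "norm (w :: complex) \<le> Y" for w Y n
    using norm_ge_zero[of w] that by (intro zero_le_power) linarith
  then show ?case
    by (intro exI[of _ 0] allI impI always_eventually) auto
next
  case (pCons p P)
  obtain N1 where N1: "\<And>n. n \<ge> N1 \<Longrightarrow> \<forall>\<^sub>F r in at_top. \<forall>z. norm z \<le> r \<longrightarrow> norm (poly p z) < r ^ n"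
    using poly_upper_bound by blast
  from pCons obtain N2 where N2: "\<And>n. n \<ge> N2 \<Longrightarrow> \<forall>\<^sub>F r in at_top. \<forall>z w Y. norm z \<le> r \<longrightarrow>
      norm w \<le> Y \<longrightarrow> r ^ n \<le> Y \<longrightarrow> norm (eval_poly2 P w z) \<le> Y ^ n"
    by blast
  have "\<forall>\<^sub>F r in at_top. \<forall>z w Y. norm z \<le> r \<longrightarrow> norm w \<le> Y \<longrightarrow> r ^ n \<le> Y \<longrightarrow>
     norm (eval_poly2 (pCons p P) w z) \<le> Y ^ n" if n: "n \<ge> N1 + N2 + 2" for n
    using N1[of N1, OF order_refl] N2[of N2, OF order_refl] eventually_ge_at_top[of 2]
  proof eventually_elim
    case (elim r)
    show ?case
    proof (intro allI impI)
      fix z w :: complex and Y assume z: "norm z \<le> r" and w: "norm w \<le> Y" and Y: "r ^ n \<le> Y"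
      have r_le: "r ^ k \<le> Y" if "k \<le> n" for k
        using power_increasing[OF that, of r] elim(3) Y by linarith
      have Y2: "Y \<ge> 2"
        using r_le[of 1] n elim by simp
      have "norm (eval_poly2 (pCons p P) w z) \<le> norm (poly p z) + norm w * norm (eval_poly2 P w z)"
        by (simp add: norm_mult[symmetric] norm_triangle_ineq)
      also have "norm (poly p z) \<le> Y ^ Suc N2"
        using less_imp_le[OF elim(1)[rule_format, OF z]] r_le[of N1] n Y2
          self_le_power[of Y "Suc N2"] by linarith
      also have "norm w * norm (eval_poly2 P w z) \<le> Y * Y ^ N2"
        using elim(2) z w r_le[of N2] n Y2 by (intro mult_mono) auto
      also have "Y ^ Suc N2 + Y * Y ^ N2 = 2 * (Y * Y ^ N2)"
        by simp
      also have "\<dots> \<le> Y * (Y * Y ^ N2)"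
        using Y2 by (intro mult_right_mono) auto
      also have "\<dots> = Y ^ (N2 + 2)"
        by simp
      also have "\<dots> \<le> Y ^ n"
        using Y2 n by (intro power_increasing) auto
      finally show "norm (eval_poly2 (pCons p P) w z) \<le> Y ^ n"
        by simp
    qed
  qed
  then show ?case by blast
qed

text \<open>Once \<open>|w|\<close> exceeds a high enough power of \<open>|z|\<close>, the
  coefficient \<open>p(z)\<close> is at most half of \<open>c * |w|\<close>.\<close>

lemma eval_poly2_pCons_lower_bound:
  assumes "c > 0"
    and "\<forall>\<^sub>F z in at_infinity. \<forall>w. norm w \<ge> norm z ^ N \<longrightarrow> c \<le> norm (eval_poly2 P w z)"
  shows "\<exists>N. \<forall>\<^sub>F z in at_infinity. \<forall>w. norm w \<ge> norm z ^ N \<longrightarrow>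
    c / 2 * norm w \<le> norm (eval_poly2 (pCons p P) w z)"
proof -
  obtain N1 where N1: "\<forall>\<^sub>F z in at_infinity. norm (poly p z) < norm z ^ N1"
    using poly_upper_bound_at_infinity by blast
  have "\<forall>\<^sub>F z in at_infinity. \<forall>w :: complex. norm w \<ge> norm z ^ (N + N1 + 1) \<longrightarrow>
    c / 2 * norm w \<le> norm (eval_poly2 (pCons p P) w z)"
    using assms(2) N1 eventually_norm_ge_at_infinity[of 1] eventually_norm_ge_at_infinity[of "2 / c"]
  proof eventually_elim
    case (elim z)
    show ?case
    proof (intro allI impI)
      fix w :: complex assume w: "norm w \<ge> norm z ^ (N + N1 + 1)"
      have le: "norm z ^ k \<le> norm w" if "k \<le> N + N1 + 1" for k
        using power_increasing[OF that, of "norm z"] elim w by simp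
      have "norm (poly p z) \<le> norm z ^ N1"
        using elim by simp
      also have "\<dots> \<le> c / 2 * norm z * norm z ^ N1"
        using elim assms(1) mult_right_mono[of 1 "c / 2 * norm z" "norm z ^ N1"]
        by (simp add: field_simps)
      also have "\<dots> \<le> c / 2 * norm w"
        using le[of "Suc N1"] assms(1) by simp
      finally have "c / 2 * norm w \<le> c * norm w - norm (poly p z)"
        by simp
      also have "\<dots> \<le> norm (w * eval_poly2 P w z) - norm (poly p z)"
        using elim(1) le[of N] mult_left_mono[of c "norm (eval_poly2 P w z)" "norm w"]
        by (simp add: norm_mult mult.commute)
      also have "\<dots> \<le> norm (eval_poly2 (pCons p P) w z)"
        using norm_triangle_ineq2[of "w * eval_poly2 P w z" "- poly p z"] by (simp add: add.commute)
      finally show "c / 2 * norm w \<le> norm (eval_poly2 (pCons p P) w z)" .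
    qed
  qed
  then show ?thesis by blast
qed

text \<open>Induction on the coefficients in \<open>w\<close>: a polynomial constant in
  \<open>w\<close> reduces to one variable, and otherwise the preceding bound applies with
  \<open>|w| \<ge> 1\<close>.\<close>

lemma eval_poly2_lower_bound:
  assumes "P \<noteq> 0"
  shows "\<exists>c>0. \<exists>N. \<forall>\<^sub>F z in at_infinity. \<forall>w. norm w \<ge> norm z ^ N \<longrightarrow>
    c \<le> norm (eval_poly2 P w z)"
  using assms
proof (induction P)
  case (pCons p P)
  show ?case
  proof (cases "P = 0")
    case True
    with pCons have "p \<noteq> 0" by simp
    from poly_lower_bound[OF this] True show ?thesis
      by (auto elim!: eventually_mono)
  next
    case False
    with pCons obtain c N where "c > 0"
      "\<forall>\<^sub>F z in at_infinity. \<forall>w. norm w \<ge> norm z ^ N \<longrightarrow> c \<le> norm (eval_poly2 P w z)"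
      by blast
    from eval_poly2_pCons_lower_bound[OF this] obtain N' where
      N': "\<forall>\<^sub>F z in at_infinity. \<forall>w. norm w \<ge> norm z ^ N' \<longrightarrow>
        c / 2 * norm w \<le> norm (eval_poly2 (pCons p P) w z)"
      by blast
    have "\<forall>\<^sub>F z in at_infinity. \<forall>w. norm w \<ge> norm z ^ N' \<longrightarrow>
        c / 2 \<le> norm (eval_poly2 (pCons p P) w z)"
      using N' eventually_norm_ge_at_infinity[of 1]
    proof eventually_elim
      case (elim z)
      show ?case
      proof (intro allI impI)
        fix w :: complex assume w: "norm w \<ge> norm z ^ N'"
        then have "norm w \<ge> 1"
          using one_le_power[OF elim(2), of N'] by linarith
        then have "c / 2 * 1 \<le> c / 2 * norm w"
          using \<open>c > 0\<close> by (intro mult_left_mono) auto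
        also have "\<dots> \<le> norm (eval_poly2 (pCons p P) w z)"
          using elim(1) w by blast
        finally show "c / 2 \<le> norm (eval_poly2 (pCons p P) w z)" by simp
      qed
    qed
    with \<open>c > 0\<close> show ?thesis
      by (intro exI[of _ "c / 2"] conjI exI[of _ N']) auto
  qed
qed simp

text \<open>As in one variable, the square absorbs the constant in the linear lower bound.\<close>

lemma norm_le_power2_eval_poly2:
  assumes "degree P \<ge> 1"
  shows "\<exists>N. \<forall>\<^sub>F z in at_infinity. \<forall>w. norm w \<ge> norm z ^ N \<longrightarrow>
    norm w \<le> norm (eval_poly2 P w z) ^ 2"
proof (cases P)
  case (pCons p P')
  with assms have "P' \<noteq> 0" by auto
  from eval_poly2_lower_bound[OF this] obtain c N where c: "c > 0" and
    "\<forall>\<^sub>F z in at_infinity. \<forall>w. norm w \<ge> norm z ^ N \<longrightarrow> c \<le> norm (eval_poly2 P' w z)"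
    by blast
  from eval_poly2_pCons_lower_bound[OF this] pCons obtain N' where
    N': "\<forall>\<^sub>F z in at_infinity. \<forall>w. norm w \<ge> norm z ^ N' \<longrightarrow> c / 2 * norm w \<le> norm (eval_poly2 P w z)"
    by blast
  have "\<forall>\<^sub>F z in at_infinity. \<forall>w :: complex. norm w \<ge> norm z ^ (N' + 1) \<longrightarrow>
    norm w \<le> norm (eval_poly2 P w z) ^ 2"
    using N' eventually_norm_ge_at_infinity[of 1] eventually_norm_ge_at_infinity[of "4 / c ^ 2"]
  proof eventually_elim
    case (elim z)
    show ?case
    proof (intro allI impI)
      fix w :: complex assume w: "norm w \<ge> norm z ^ (N' + 1)"
      have le: "norm z ^ k \<le> norm w" if "k \<le> N' + 1" for k
        using power_increasing[OF that, of "norm z"] elim w by simp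
      have "(c / 2 * norm w) ^ 2 \<le> norm (eval_poly2 P w z) ^ 2"
        using elim(1) le[of N'] c by (intro power_mono) auto
      moreover have "4 / c ^ 2 \<le> norm w"
        using elim(3) le[of 1] by simp
      then have "1 * norm w \<le> (c ^ 2 / 4 * norm w) * norm w"
        using c by (intro mult_right_mono) (auto simp: field_simps)
      ultimately show "norm w \<le> norm (eval_poly2 P w z) ^ 2"
        by (simp add: power2_eq_square field_simps)
    qed
  qed
  then show ?thesis by blast
qed

section \<open>The criterion applied to \<open>P(f(Q(z)), z)\<close>\<close>

theorem theorem4p1:
  fixes f g :: "complex \<Rightarrow> complex"
    and P :: "complex poly poly" and Q :: "complex poly"
    and m R :: real
  assumes "transcendental_entire f"
    and "log_regular f"
    and "m > 1"
    and "annular_domain_property m f"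
    and "degree P \<ge> 1"
    and "degree Q \<ge> 1"
    and "\<And>z. g z = eval_poly2 P (f (poly Q z)) z"
    and "R > 0"
    and "\<And>r. r \<ge> R \<Longrightarrow> max_modulus g r > r"
  shows "spiders_web (A_set R g)"
proof -
  have holo_f: "f holomorphic_on UNIV"
    using assms(1) by (simp add: transcendental_entire_def)
  have holo_fQ: "(\<lambda>z. f (poly Q z)) holomorphic_on UNIV"
    by (rule holomorphic_on_compose_gen[OF _ holo_f, unfolded o_def]) (auto intro!: holomorphic_intros)
  have "g = (\<lambda>z. eval_poly2 P (f (poly Q z)) z)"
    using assms(7) by blast
  with holomorphic_on_eval_poly2[OF holo_fQ] have "g holomorphic_on UNIV"
    by simp
  then interpret expanding_entire g R
    using assms(8,9) by unfold_locales
  let ?Mf = "max_modulus f"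
  obtain r0 where r0: "r0 > 1" "\<And>r. r \<ge> r0 \<Longrightarrow> ?Mf r > 1"
    "\<And>J :: nat. \<exists>k\<ge>1. \<forall>r\<ge>r0. ?Mf (r ^ k) \<ge> ?Mf r ^ (k * J)"
    "\<And>N :: nat. \<forall>\<^sub>F r in at_top. ?Mf r \<ge> r ^ N"
    using log_regular_growth[OF assms(2)] by metis
  obtain \<rho>0 where \<rho>0: "\<And>\<rho>. \<rho> \<ge> \<rho>0 \<Longrightarrow> \<exists>D. simply_connected_domain D \<and>
      ball 0 \<rho> \<subseteq> D \<and> D \<subseteq> ball 0 (\<rho> powr m) \<and> (\<forall>z\<in>frontier D. norm (f z) \<ge> ?Mf \<rho>)"
    using assms(4) unfolding annular_domain_property_def by blast
  obtain m' :: nat where m': "m \<le> real m'"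
    using real_arch_simple by blast
  with assms(3) have m'_pos: "m' \<ge> 1" by auto
  obtain L where L: "L \<ge> 1" "\<forall>\<^sub>F r in at_top. \<forall>z. norm z \<le> r \<longrightarrow> norm (poly Q z) < r ^ L"
  proof -
    obtain N where "\<And>n. n \<ge> N \<Longrightarrow> \<forall>\<^sub>F r in at_top. \<forall>z. norm z \<le> r \<longrightarrow> norm (poly Q z) < r ^ n"
      using poly_upper_bound by blast
    then show thesis
      by (intro that[of "max 1 N"]) auto
  qed
  obtain z1 where z1: "\<And>z. norm z \<ge> z1 \<Longrightarrow> norm z \<le> norm (poly Q z) ^ 2"
    using norm_le_power2_poly[OF assms(6)] unfolding eventually_at_infinity by blast
  obtain NU where NU: "\<forall>\<^sub>F r in at_top. \<forall>z w Y. norm z \<le> r \<longrightarrow> norm w \<le> Y \<longrightarrow> r ^ NU \<le> Y \<longrightarrow>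
     norm (eval_poly2 P w z) \<le> Y ^ NU"
    using eval_poly2_upper_bound[of P] by blast
  obtain NL z2 where NL: "\<And>z w. norm z \<ge> z2 \<Longrightarrow> norm w \<ge> norm z ^ NL \<Longrightarrow>
      norm w \<le> norm (eval_poly2 P w z) ^ 2"
    using norm_le_power2_eval_poly2[OF assms(5)] unfolding eventually_at_infinity by blast
  \<comment> \<open>The factor 2 comes from \<open>|z| \<le> |Q(z)|^2\<close>, \<open>L\<close> from
    the growth of \<open>Q\<close>, and \<open>m'\<close> from the annular domain property.\<close>
  define e where "e = 2 * L * m'"
  \<comment> \<open>The main term pays for the square of \<open>b (M S)\<close>; the extra 1 makes
    the final inequality strict and ensures \<open>J \<ge> 1\<close>.\<close>
  define J where "J = 2 * NU * e + 1"
  obtain k where k: "k \<ge> 1" "\<And>r. r \<ge> r0 \<Longrightarrow> ?Mf (r ^ k) \<ge> ?Mf r ^ (k * J)"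
    using r0(3) by blast
  define b where "b S = S ^ (k * e)" for S :: real
  obtain rQ where rQ: "\<And>r z. r \<ge> rQ \<Longrightarrow> norm z \<le> r \<Longrightarrow> norm (poly Q z) < r ^ L"
    using L(2) unfolding eventually_at_top_linorder by blast
  obtain rU where rU: "\<And>r z w Y. r \<ge> rU \<Longrightarrow> norm z \<le> r \<Longrightarrow> norm w \<le> Y \<Longrightarrow> r ^ NU \<le> Y \<Longrightarrow>
     norm (eval_poly2 P w z) \<le> Y ^ NU"
    using NU unfolding eventually_at_top_linorder by blast
  obtain r1 where r1: "\<And>r. r \<ge> r1 \<Longrightarrow> ?Mf r \<ge> r ^ NU" "\<And>r. r \<ge> r1 \<Longrightarrow> ?Mf r \<ge> r ^ (e * NL)"
    using eventually_conj[OF r0(4)[of NU] r0(4)[of "e * NL"]]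
    unfolding eventually_at_top_linorder by blast
  define S0 where "S0 = max 1 (max R (max r0 (max \<rho>0 (max z1 (max z2 (max rQ (max rU r1)))))))"
  show ?thesis
  proof (rule spiders_web_criterion[of S0 b])
    fix S assume "S \<ge> S0"
    then have S: "S \<ge> 1" "S \<ge> R" "S \<ge> r0" "S \<ge> \<rho>0" "S \<ge> z1" "S \<ge> z2" "S \<ge> rQ" "S \<ge> rU" "S \<ge> r1"
      by (simp_all only: S0_def max.bounded_iff)
    have power_ge: "S \<le> S ^ n" if "n \<ge> 1" for n
      using self_le_power[OF S(1)] that by simp
    define X where "X = ?Mf (S ^ L)"
    \<comment> \<open>As a power of \<open>S ^ L\<close> it lets \<open>?Mf \<rho>\<close> be
      compared with \<open>X\<close>; as \<open>(S ^ k) ^ L\<close> it bounds \<open>Q\<close> on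
      the disc of radius \<open>S ^ k\<close>, which contains that of radius
      \<open>S\<close>.\<close>
    define \<rho> where "\<rho> = (S ^ L) ^ k"
    have \<rho>_eq: "\<rho> = (S ^ k) ^ L"
      by (simp add: \<rho>_def mult.commute flip: power_mult)
    have SL: "S \<le> S ^ L" "S \<le> S ^ k" "S \<le> \<rho>"
      using power_ge[of L] power_ge[of k] power_ge[of "L * k"] L(1) k(1)
      by (auto simp: \<rho>_def simp flip: power_mult)
    have X: "X > 1" "X \<ge> (S ^ L) ^ NU" "X \<ge> (S ^ L) ^ (e * NL)" "X ^ (k * J) \<le> ?Mf \<rho>"
      using r0(2) r1 k(2) SL(1) S unfolding X_def \<rho>_def by auto
    have MS: "M S \<le> X ^ NU"
    proof (rule max_modulus_le)
      fix z :: complex assume z: "norm z = S"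
      have "norm (f (poly Q z)) \<le> X"
        unfolding X_def using rQ[of S z] S z by (intro norm_le_max_modulus holo_f) auto
      moreover have "S ^ NU \<le> X"
        using X(2) power_mono[OF SL(1), of NU] S(1) by linarith
      ultimately show "norm (g z) \<le> X ^ NU"
        using rU[of S z] z S by (simp add: assms(7))
    qed (use S in simp)
    obtain D where D: "simply_connected_domain D" "ball 0 \<rho> \<subseteq> D" "D \<subseteq> ball 0 (\<rho> powr m)"
      "\<And>z. z \<in> frontier D \<Longrightarrow> norm (f z) \<ge> ?Mf \<rho>"
      using \<rho>0[of \<rho>] SL S by auto
    have open_D: "open D"
      using D(1) by (simp add: simply_connected_domain_def)
    define G where "G = poly Q -` D"
    have cont_Q: "continuous_on UNIV (poly Q)"
      by (intro continuous_intros)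
    have open_G: "open G"
      using continuous_on_open_vimage[OF open_UNIV, of "poly Q"] cont_Q open_D by (simp add: G_def)
    have ball_G: "ball 0 S \<subseteq> G"
    proof
      fix z :: complex assume "z \<in> ball 0 S"
      then have "norm (poly Q z) < \<rho>"
        unfolding \<rho>_eq using SL(2) S by (intro rQ) auto
      with D(2) show "z \<in> G" by (auto simp: G_def)
    qed
    have G_ball: "G \<subseteq> ball 0 (b S)"
    proof
      fix z assume z: "z \<in> G"
      have "norm z < b S"
      proof (cases "norm z \<ge> z1")
        case True
        have "norm (poly Q z) < \<rho> powr m"
          using z D(3) by (auto simp: G_def)
        also have "\<dots> \<le> \<rho> powr real m'"
          using m' S(1) SL(3) by (intro powr_mono) auto
        also have "\<dots> = \<rho> ^ m'"
          using S(1) SL(3) by (intro powr_realpow) auto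
        finally have "norm (poly Q z) ^ 2 < (\<rho> ^ m') ^ 2"
          by (intro power_strict_mono) auto
        also have "\<dots> = b S"
          by (simp add: b_def \<rho>_def e_def mult_ac flip: power_mult)
        finally show ?thesis
          using z1[OF True] by simp
      next
        case False
        with S have "norm z < S" by simp
        also have "S \<le> b S"
          using power_ge[of "k * e"] k(1) L(1) m'_pos by (simp add: b_def e_def)
        finally show ?thesis .
      qed
      then show "z \<in> ball 0 (b S)" by simp
    qed
    have "b (M S) < norm (g z)" if z: "z \<in> frontier G" for z
    proof -
      have "z \<notin> G"
        using z open_G by (simp add: frontier_def interior_open)
      with ball_G have z_ge: "norm z \<ge> S" by force
      have "closure G \<subseteq> cball 0 (b S)"
        using G_ball ball_subset_cball by (intro closure_minimal) blast+
      with z have z_le: "norm z \<le> b S"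
        by (auto simp: frontier_def)
      \<comment> \<open>By continuity \<open>Q\<close> maps the frontier of \<open>G\<close> into
        the frontier of \<open>D\<close>, where \<open>f\<close> is large.\<close>
      have "closed (poly Q -` closure D)"
        using continuous_on_closed_vimage[OF closed_UNIV, of "poly Q"] cont_Q by simp
      moreover have "G \<subseteq> poly Q -` closure D"
        using closure_subset by (auto simp: G_def)
      ultimately have "closure G \<subseteq> poly Q -` closure D"
        by (rule closure_minimal[rotated])
      with z \<open>z \<notin> G\<close> have "poly Q z \<in> frontier D"
        using open_D by (auto simp: frontier_def G_def interior_open)
      define w where "w = f (poly Q z)"
      have w: "norm w \<ge> X ^ (k * J)"
        using D(4)[OF \<open>poly Q z \<in> frontier D\<close>] X(4) by (simp add: w_def)
      \<comment> \<open>This chain verifies \<open>|w| \<ge> |z|^NL\<close>, the condition for the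
        lower bound on \<open>P\<close>.\<close>
      have "norm z ^ NL \<le> b S ^ NL"
        using z_le by (intro power_mono) auto
      also have "\<dots> = (S ^ (e * NL)) ^ k"
        by (simp add: b_def mult_ac flip: power_mult)
      also have "\<dots> \<le> ((S ^ L) ^ (e * NL)) ^ k"
        using S(1) SL(1) by (intro power_mono) auto
      also have "\<dots> \<le> X ^ k"
        using X(3) S(1) by (intro power_mono) auto
      also have "\<dots> \<le> X ^ (k * J)"
        using X(1) by (intro power_increasing) (auto simp: J_def)
      finally have "norm w \<le> norm (g z) ^ 2"
        using NL[of z w] w z_ge S by (simp add: w_def assms(7))
      have "b (M S) \<le> (X ^ NU) ^ (k * e)"
        unfolding b_def using MS expanding[OF S(2)] S(1) by (intro power_mono) auto
      \<comment> \<open>Squares are compared because the lower bound controls only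
        \<open>|g(z)|^2\<close>.\<close>
      then have "b (M S) ^ 2 \<le> ((X ^ NU) ^ (k * e)) ^ 2"
        using expanding[OF S(2)] S(1) by (intro power_mono) (auto simp: b_def)
      also have "\<dots> = X ^ (k * (2 * NU * e))"
        by (simp add: mult_ac flip: power_mult)
      also have "\<dots> < X ^ (k * J)"
        using X(1) k(1) by (intro power_strict_increasing) (auto simp: J_def)
      also note w
      also note \<open>norm w \<le> norm (g z) ^ 2\<close>
      finally show ?thesis
        by (rule power_less_imp_less_base) simp
    qed
    with open_G ball_G G_ball
    show "\<exists>G. open G \<and> ball 0 S \<subseteq> G \<and> G \<subseteq> ball 0 (b S) \<and> (\<forall>z\<in>frontier G. norm (g z) > b (M S))"
      by blast
  qed
qed

end
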